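(* Let $V$ be a finite-dimensional vector space and $\mathcal{X}=(X_1,\dots,X_n)$ a family of subspaces of $V$. Then $\mathcal{X}$ has a $q$-transversal if and only if for every nonempty $J\subseteq\{1,\dots,n\}$, \[ \dim \mathcal{X}(J)+|J|\le\dim V. \]
   Context: $\mathcal{X}(J)=\bigcap_{j\in J}X_j$. A $q$-transversal of $\mathcal{X}$ is a subspace $T\le V$ of dimension $n$ such that every vector basis $B$ of $T$ admits an ordering $B=\{b_1,\dots,b_n\}$ with $b_i\notin X_i$ for all $i\in\{1,\dots,n\}$. *)

theory Defs
  imports Complex_Main
begin

text \<open>\<open>scale\<close> is the scalar multiplication of a vector space whose carrier \<open>V\<close> is the
  whole type \<open>'b\<close>; the family of subspaces is \<open>X 1, \<dots>, X n\<close>.\<close>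

definition family_meet :: "(nat \<Rightarrow> 'b set) \<Rightarrow> nat set \<Rightarrow> 'b set" where
  "family_meet X J = (\<Inter>j\<in>J. X j)"

definition vector_basis ::
  "('a::field \<Rightarrow> 'b::ab_group_add \<Rightarrow> 'b) \<Rightarrow> 'b set \<Rightarrow> 'b set \<Rightarrow> bool" where
  "vector_basis scale T B \<longleftrightarrow> \<not> module.dependent scale B \<and> module.span scale B = T"

text \<open>An ordering of a basis \<open>B\<close> is a bijection from \<open>{1..n}\<close> onto \<open>B\<close>.\<close>

definition q_transversal ::
  "('a::field \<Rightarrow> 'b::ab_group_add \<Rightarrow> 'b) \<Rightarrow> nat \<Rightarrow> (nat \<Rightarrow> 'b set) \<Rightarrow> 'b set \<Rightarrow> bool" where
  "q_transversal scale n X T \<longleftrightarrow>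
     module.subspace scale T \<and> vector_space.dim scale T = n \<and>
     (\<forall>B. vector_basis scale T B \<longrightarrow>
        (\<exists>b. bij_betw b {1..n} B \<and> (\<forall>i\<in>{1..n}. b i \<notin> X i)))"

end

theory Submission
  imports Defs
begin

text \<open>
  Necessity: extend a basis of \<open>T \<inter> X(J)\<close> to one of \<open>T\<close>. In a good ordering no \<open>b\<^sub>j\<close> with
  \<open>j \<in> J\<close> lies in \<open>X(J)\<close>, so \<open>dim (T \<inter> X(J)) + |J| \<le> n\<close>, and the dimension formula applies.

  Sufficiency (over an arbitrary, possibly finite field): as in Rado's proof of Hall's theorem,
  a subspace of codimension at least 2 in the family can be enlarged while keeping the dimension
  condition, because it is an intersection \<open>A \<inter> B\<close> of two larger subspaces and submodularity
  forbids that both replacements fail. Hence all \<open>X\<^sub>i\<close> may be taken to be hyperplanes, whose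
  total intersection then has codimension exactly \<open>n\<close>. Any complement \<open>T\<close> of it is a
  \<open>q\<close>-transversal: the linear forms defining the hyperplanes are a basis of the dual of \<open>T\<close>, so
  their matrix on a basis \<open>B\<close> is nonsingular and some permutation avoids its zero entries; this
  permutation is built by an induction that mimics Laplace expansion.
\<close>

context finite_dimensional_vector_space
begin

section \<open>Dimension inequalities, complements and intersections with hyperplanes\<close>

lemma dim_add_le_dim_Int:
  assumes "subspace S" "subspace T"
  shows "dim S + dim T \<le> dim (S \<inter> T) + dimension"
  using dim_sums_Int[OF assms] dim_subset_UNIV[of "{x + y |x y. x \<in> S \<and> y \<in> T}"] by linarith

text \<open>Both subspaces lie in \<open>U\<close>, so their sum does too. Later \<open>U\<close> is
  the meet over the indices common to two subfamilies.\<close>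

lemma dim_modular_le:
  assumes "subspace S" "subspace T" "subspace U" "S \<subseteq> U" "T \<subseteq> U"
  shows "dim S + dim T \<le> dim (S \<inter> T) + dim U"
proof -
  have "{x + y |x y. x \<in> S \<and> y \<in> T} \<subseteq> U"
    using assms by (auto intro: subspace_add)
  then have "dim {x + y |x y. x \<in> S \<and> y \<in> T} \<le> dim U"
    by (rule dim_subset)
  then show ?thesis
    using dim_sums_Int[OF assms(1,2)] by linarith
qed

lemma subspace_family_meet:
  "(\<And>i. i \<in> J \<Longrightarrow> subspace (X i)) \<Longrightarrow> subspace (family_meet X J)"
  unfolding family_meet_def by (rule subspace_Inter) auto

lemma subspace_complement_exists:
  assumes "subspace S"
  obtains T where "subspace T" "S \<inter> T = {0}" "dim S + dim T = dimension"
proof -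
  obtain A where A: "A \<subseteq> S" "independent A" "S \<subseteq> span A" "card A = dim S"
    by (rule basis_exists)
  obtain B where B: "A \<subseteq> B" "independent B" "UNIV \<subseteq> span B"
    using maximal_independent_subset_extend[OF subset_UNIV A(2)] by metis
  let ?T = "span (B - A)"
  have SA: "span A = S"
    using A assms by (simp add: span_subspace)
  have fin: "finite B"
    using B(2) by (rule finiteI_independent)
  have cB: "card B = dimension"
    using B by (metis dim_UNIV dimension_def basis_card_eq_dim subset_UNIV)
  have "dim ?T = card (B - A)"
    using B(2) by (metis Diff_subset dim_span_eq_card_independent independent_mono)
  then have sum: "dim S + dim ?T = dimension"
    using A(4) B(1) fin cB by (metis card_Diff_subset card_mono finite_subset le_add_diff_inverse)
  have "span B = {x + y |x y. x \<in> S \<and> y \<in> ?T}"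
    using span_Un[of A "B - A"] B(1) SA by (simp add: Un_absorb1 sup_commute)
  then have "dim {x + y |x y. x \<in> S \<and> y \<in> ?T} = dimension"
    using B(3) by (metis dim_UNIV dimension_def top.extremum_uniqueI)
  \<comment> \<open>The sum is the whole space and the dimensions already add up, so nothing is left
    for the intersection.\<close>
  then have "dim (S \<inter> ?T) = 0"
    using dim_sums_Int[OF assms subspace_span[of "B - A"]] sum by linarith
  moreover have "0 \<in> S \<inter> ?T"
    using assms subspace_0 span_zero by blast
  ultimately have "S \<inter> ?T = {0}"
    by (auto simp: dim_eq_0)
  then show thesis
    using that sum subspace_span by blast
qed

text \<open>Each intersection with a subspace of codimension at most 1 lowers the dimension by at
  most 1.\<close>

lemma dim_Int_hyperplanes:
  assumes "finite I" "subspace S" "\<And>i. i \<in> I \<Longrightarrow> subspace (H i)"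
    and "\<And>i. i \<in> I \<Longrightarrow> dimension \<le> dim (H i) + 1"
  shows "dim S \<le> dim (S \<inter> family_meet H I) + card I"
  using assms
proof (induction I rule: finite_induct)
  case empty
  then show ?case by (simp add: family_meet_def)
next
  case (insert i I)
  have sub: "subspace (S \<inter> family_meet H I)"
    using insert.prems by (intro subspace_inter subspace_family_meet) auto
  have "dim (S \<inter> family_meet H I) + dim (H i) \<le> dim (S \<inter> family_meet H I \<inter> H i) + dimension"
    using insert.prems by (intro dim_add_le_dim_Int sub) auto
  moreover have "S \<inter> family_meet H I \<inter> H i = S \<inter> family_meet H (insert i I)"
    by (auto simp: family_meet_def)
  moreover have "dimension \<le> dim (H i) + 1"
    using insert.prems by simp
  moreover have "dim S \<le> dim (S \<inter> family_meet H I) + card I"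
    using insert.prems by (intro insert.IH) auto
  ultimately show ?case
    using insert.hyps by simp
qed

section \<open>Enlarging a family of subspaces to hyperplanes\<close>

lemma subspace_codim_ge_2_eq_Int:
  assumes "subspace S" "dim S + 1 < dimension"
  obtains A B where "subspace A" "subspace B" "dim A = dim S + 1" "dim B = dim S + 1" "S = A \<inter> B"
proof -
  have spanS: "span S = S"
    using assms(1) by simp
  have "S \<noteq> UNIV"
    using assms(2) by (auto simp: dimension_def)
  then obtain u where u: "u \<notin> S" by blast
  define A where "A = span (insert u S)"
  have dA: "dim A = dim S + 1"
    using u unfolding A_def dim_span dim_insert spanS by simp
  then have "A \<noteq> UNIV"
    using assms(2) by (auto simp: dimension_def)
  then obtain v where v: "v \<notin> A" by blast
  define B where "B = span (insert v S)"
  have SA: "S \<subseteq> A" and SB: "S \<subseteq> B"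
    unfolding A_def B_def using span_superset by blast+
  have dB: "dim B = dim S + 1"
    using v SA unfolding B_def dim_span dim_insert spanS by auto
  have "w \<in> S" if "w \<in> A" "w \<in> B" for w
  proof (rule ccontr)
    \<comment> \<open>Exchange: a common vector \<open>w\<close> outside \<open>S\<close> would put
      \<open>v\<close> into \<open>span (insert w S)\<close>, hence into \<open>A\<close>.\<close>
    assume "w \<notin> S"
    then have "v \<in> span (insert w S)"
      using that(2) spanS unfolding B_def by (metis in_span_insert)
    moreover have "span (insert w S) \<subseteq> A"
      using that(1) SA unfolding A_def by (simp add: span_minimal)
    ultimately show False
      using v by blast
  qed
  then have AB: "S = A \<inter> B"
    using SA SB by blast
  have "subspace A" "subspace B"
    by (simp_all add: A_def B_def)
  from that[OF this dA dB AB] show thesis .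
qed

text \<open>A dual form of Rado's theorem on independent transversals.\<close>

lemma hyperplanes_in_general_position_exist:
  assumes "finite I" "\<And>i. i \<in> I \<Longrightarrow> subspace (X i)"
    and "\<And>J. J \<subseteq> I \<Longrightarrow> dim (family_meet X J) + card J \<le> dimension"
  shows "\<exists>H. (\<forall>i\<in>I. subspace (H i) \<and> X i \<subseteq> H i \<and> dim (H i) + 1 = dimension)
           \<and> dim (family_meet H I) + card I \<le> dimension"
  using assms(2,3)
\<comment> \<open>The total codimension drops with every enlargement.\<close>
proof (induction "\<Sum>i\<in>I. dimension - dim (X i)" arbitrary: X rule: less_induct)
  case less
  show ?case
  proof (cases "\<forall>i\<in>I. dim (X i) + 1 = dimension")
    case True
    then show ?thesis
      using less.prems by blast
  next
    case False
    then obtain i where i: "i \<in> I" "dim (X i) + 1 \<noteq> dimension" by blast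
    have "dim (X i) + 1 \<le> dimension"
      using less.prems(2)[of "{i}"] i(1) by (simp add: family_meet_def)
    with i have lt: "dim (X i) + 1 < dimension" by simp
    obtain A B where AB: "subspace A" "subspace B" "dim A = dim (X i) + 1" "dim B = dim (X i) + 1"
        "X i = A \<inter> B"
      using subspace_codim_ge_2_eq_Int[OF less.prems(1)[OF i(1)] lt] by blast
    \<comment> \<open>Replacing \<open>X i\<close> by \<open>C\<close> affects only index sets
      containing \<open>i\<close>. In \<open>cond\<close> such a set is written without
      \<open>i\<close>, which the extra 1 counts.\<close>
    have enlarge: ?thesis
      if C: "subspace C" "dim C = dim (X i) + 1" "X i \<subseteq> C"
        and cond: "\<And>J. J \<subseteq> I - {i} \<Longrightarrow> dim (C \<inter> family_meet X J) + card J + 1 \<le> dimension" for C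
    proof -
      let ?Y = "X(i := C)"
      \<comment> \<open>Only summand \<open>i\<close> changes; by \<open>lt\<close> the truncated
        subtraction there really decreases.\<close>
      have "(\<Sum>k\<in>I. dimension - dim (?Y k)) < (\<Sum>k\<in>I. dimension - dim (X k))"
        using assms(1) i(1) C(2) lt by (intro sum_strict_mono_ex1) auto
      moreover have "subspace (?Y k)" if "k \<in> I" for k
        using less.prems(1) C that by simp
      moreover have "dim (family_meet ?Y J) + card J \<le> dimension" if J: "J \<subseteq> I" for J
      proof (cases "i \<in> J")
        case True
        have "family_meet ?Y J = C \<inter> family_meet X (J - {i})"
          using True by (auto simp: family_meet_def)
        moreover have "card J = card (J - {i}) + 1"
          using True J assms(1) by (metis Suc_eq_plus1 card_Suc_Diff1 finite_subset)
        ultimately show ?thesis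
          using cond[of "J - {i}"] J by auto
      next
        case False
        then have "family_meet ?Y J = family_meet X J"
          by (auto simp: family_meet_def)
        then show ?thesis
          using less.prems(2) J by simp
      qed
      ultimately obtain H where H: "\<forall>k\<in>I. subspace (H k) \<and> ?Y k \<subseteq> H k \<and> dim (H k) + 1 = dimension"
          "dim (family_meet H I) + card I \<le> dimension"
        using less.hyps[of ?Y] by blast
      have "X k \<subseteq> ?Y k" for k
        using C(3) by simp
      then show ?thesis
        using H by blast
    qed
    show ?thesis
    proof (rule ccontr)
      assume neg: "\<not> ?thesis"
      have fails: "\<exists>J\<subseteq>I - {i}. dimension < dim (C \<inter> family_meet X J) + card J + 1"
        if "subspace C" "dim C = dim (X i) + 1" "X i \<subseteq> C" for C
      proof (rule ccontr)
        assume "\<not> ?thesis"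
        then have "\<And>J. J \<subseteq> I - {i} \<Longrightarrow> dim (C \<inter> family_meet X J) + card J + 1 \<le> dimension"
          by (meson not_less)
        from enlarge[OF that this] neg show False by blast
      qed
      obtain J where J: "J \<subseteq> I - {i}" "dimension < dim (A \<inter> family_meet X J) + card J + 1"
        using fails[of A] AB by blast
      obtain K where K: "K \<subseteq> I - {i}" "dimension < dim (B \<inter> family_meet X K) + card K + 1"
        using fails[of B] AB by blast
      have fin: "finite J" "finite K"
        using J K assms(1) by (meson finite_Diff finite_subset)+
      have subm: "subspace (family_meet X L)" if "L \<subseteq> I" for L
        using that less.prems(1) subspace_family_meet by blast
      have JK: "J \<subseteq> I" "K \<subseteq> I" "J \<inter> K \<subseteq> I"
        using J K by auto
      let ?P = "A \<inter> family_meet X J" and ?Q = "B \<inter> family_meet X K"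
      \<comment> \<open>The two failures give
        \<open>dim ?P + dim ?Q + card J + card K \<ge> 2 * dimension\<close>. Submodularity and the
        condition for \<open>insert i (J \<union> K)\<close> and \<open>J \<inter> K\<close> bound
        the same sum by \<open>2 * dimension - 1\<close>, the 1 coming from the index
        \<open>i\<close>.\<close>
      have "dim ?P + dim ?Q \<le> dim (?P \<inter> ?Q) + dim (family_meet X (J \<inter> K))"
        using AB JK subm
        by (intro dim_modular_le subspace_inter) (auto simp: family_meet_def)
      moreover have "?P \<inter> ?Q = family_meet X (insert i (J \<union> K))"
        using AB(5) by (auto simp: family_meet_def)
      moreover have "dim (family_meet X (insert i (J \<union> K))) + (card (J \<union> K) + 1) \<le> dimension"
      proof -
        have "card (insert i (J \<union> K)) = card (J \<union> K) + 1"
          using J(1) K(1) fin by (subst card_insert_disjoint) auto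
        then show ?thesis
          using less.prems(2)[of "insert i (J \<union> K)"] J(1) K(1) i(1) by auto
      qed
      moreover have "dim (family_meet X (J \<inter> K)) + card (J \<inter> K) \<le> dimension"
        using less.prems(2) JK by blast
      moreover have "card J + card K = card (J \<union> K) + card (J \<inter> K)"
        using fin by (rule card_Un_Int)
      ultimately show False
        using J(2) K(2) by simp
    qed
  qed
qed

section \<open>Matching a basis with hyperplanes\<close>

text \<open>Expansion along row \<open>k\<close> of the matrix of linear forms: the other
  hyperplanes cut \<open>span B\<close> in a line, whose generator \<open>v\<close> has the
  cofactors as coordinates up to a common factor. As \<open>v \<notin> H k\<close>, some
  \<open>c\<close> has both a nonzero entry and a nonzero cofactor; \<open>k\<close> gets
  \<open>c\<close> and induction handles the rest.\<close>

lemma hyperplanes_matching_exists: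
  assumes "finite I" "independent B" "card B = card I"
    and "\<And>i. i \<in> I \<Longrightarrow> subspace (H i)" "\<And>i. i \<in> I \<Longrightarrow> dimension \<le> dim (H i) + 1"
    and "span B \<inter> family_meet H I = {0}"
  shows "\<exists>b. bij_betw b I B \<and> (\<forall>i\<in>I. b i \<notin> H i)"
  using assms
proof (induction I arbitrary: B rule: finite_induct)
  case empty
  then have "B = {}"
    using finiteI_independent by fastforce
  then show ?case by (simp add: bij_betw_def)
next
  case (insert k I)
  let ?L = "span B \<inter> family_meet H I"
  have finB: "finite B"
    using insert.prems(1) by (rule finiteI_independent)
  have subL: "subspace ?L"
    using insert.prems by (intro subspace_inter subspace_family_meet) auto
  have "?L \<inter> H k = span B \<inter> family_meet H (insert k I)"
    by (auto simp: family_meet_def)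
  then have Lk: "?L \<inter> H k = {0}"
    using insert.prems(5) by simp
  have "dim ?L + dim (H k) \<le> dim (?L \<inter> H k) + dimension"
    using dim_add_le_dim_Int[OF subL] insert.prems(3) by blast
  then have dL: "dim ?L \<le> 1"
    using Lk insert.prems(4)[of k] by simp
  \<comment> \<open>\<open>B\<close> has \<open>card I + 1\<close> elements, so together with
    \<open>dL\<close> this makes \<open>?L\<close> a line.\<close>
  have "dim (span B) \<le> dim ?L + card I"
    using insert.prems insert.hyps by (intro dim_Int_hyperplanes) auto
  then have "dim ?L \<noteq> 0"
    using insert.prems(2) insert.hyps dim_span_eq_card_independent[OF insert.prems(1)]
    by (simp del: dim_eq_0)
  then obtain v where v: "v \<in> ?L" "v \<noteq> 0"
    by (auto simp: dim_eq_0)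
  have vk: "v \<notin> H k"
    using v Lk by blast
  \<comment> \<open>\<open>v \<notin> span (B - {c})\<close> says that \<open>v\<close> has a
    nonzero coordinate at \<open>c\<close>. If every such \<open>c\<close> lay in
    \<open>H k\<close>, so would \<open>v\<close>.\<close>
  have "\<exists>c\<in>B. c \<notin> H k \<and> v \<notin> span (B - {c})"
  proof (rule ccontr)
    assume neg: "\<not> ?thesis"
    have rep: "c \<in> H k" if "representation B v c \<noteq> 0" for c
    proof (rule ccontr)
      assume c: "c \<notin> H k"
      have cB: "c \<in> B"
        using that representation_ne_zero by blast
      then have vs: "v \<in> span (B - {c})"
        using neg c by blast
      have "representation B v = representation (B - {c}) v"
        using insert.prems(1) vs by (intro representation_extend) auto
      then show False
        using that representation_ne_zero[of "B - {c}" v c] by auto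
    qed
    have "(\<Sum>c | representation B v c \<noteq> 0. scale (representation B v c) c) = v"
      using sum_nonzero_representation_eq[OF insert.prems(1)] v(1) by blast
    moreover have "(\<Sum>c | representation B v c \<noteq> 0. scale (representation B v c) c) \<in> H k"
      using rep insert.prems(3)[of k] by (intro subspace_sum subspace_scale) auto
    ultimately show False
      using vk by simp
  qed
  then obtain c where c: "c \<in> B" "c \<notin> H k" "v \<notin> span (B - {c})" by blast
  have "{v} \<subseteq> ?L" "independent {v}"
    using v by auto
  then have Lv: "?L \<subseteq> span {v}"
    using dL by (intro card_ge_dim_independent) auto
  \<comment> \<open>The trivial intersection survives dropping \<open>c\<close> and
    \<open>H k\<close>: what remains lies on the line through \<open>v\<close>, and \<open>v\<close>
    is outside the smaller span.\<close>
  have "w = 0" if w: "w \<in> span (B - {c})" "w \<in> family_meet H I" for w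
  proof -
    have "w \<in> ?L"
      using w span_mono[of "B - {c}" B] by blast
    then obtain a where a: "w = scale a v"
      using Lv by (auto simp: span_singleton)
    have "a = 0"
    proof (rule ccontr)
      assume "a \<noteq> 0"
      then have "v = scale (inverse a) w"
        using a by simp
      then show False
        using c(3) w(1) span_scale by metis
    qed
    then show ?thesis
      using a by simp
  qed
  moreover have "0 \<in> family_meet H I"
    using subL subspace_0 by blast
  ultimately have "span (B - {c}) \<inter> family_meet H I = {0}"
    using span_zero by blast
  moreover have "card (B - {c}) = card I"
    using c(1) insert.prems(2) insert.hyps finB by simp
  moreover have "independent (B - {c})"
    using insert.prems(1) independent_mono by blast
  ultimately obtain b where b: "bij_betw b I (B - {c})" "\<forall>i\<in>I. b i \<notin> H i"
    using insert.IH[of "B - {c}"] insert.prems(3,4) by blast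
  have "bij_betw (b(k := c)) I (B - {c})"
    using b(1) insert.hyps(2) by (metis bij_betw_cong fun_upd_other)
  then have "bij_betw (b(k := c)) (I \<union> {k}) ((B - {c}) \<union> {c})"
    using notIn_Un_bij_betw[of k I "b(k := c)" "B - {c}"] insert.hyps(2) by simp
  then have "bij_betw (b(k := c)) (insert k I) B"
    using c(1) by (simp add: insert_absorb)
  moreover have "\<forall>i\<in>insert k I. (b(k := c)) i \<notin> H i"
    using b(2) c(2) by auto
  ultimately show ?case by blast
qed

section \<open>Necessity and sufficiency of the dimension condition\<close>

lemma q_transversal_imp_dim_le:
  assumes T: "q_transversal scale n X T"
    and X: "\<And>i. i \<in> {1..n} \<Longrightarrow> subspace (X i)" and J: "J \<subseteq> {1..n}"
  shows "dim (family_meet X J) + card J \<le> dimension"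
proof -
  have subT: "subspace T" and dT: "dim T = n"
    and ord: "\<And>B. vector_basis scale T B \<Longrightarrow> \<exists>b. bij_betw b {1..n} B \<and> (\<forall>i\<in>{1..n}. b i \<notin> X i)"
    using T by (auto simp: q_transversal_def)
  have subM: "subspace (family_meet X J)"
    using X J subspace_family_meet by blast
  let ?S = "T \<inter> family_meet X J"
  obtain A where A: "A \<subseteq> ?S" "independent A" "?S \<subseteq> span A" "card A = dim ?S"
    by (rule basis_exists)
  obtain B where B: "A \<subseteq> B" "B \<subseteq> T" "independent B" "T \<subseteq> span B"
    using maximal_independent_subset_extend[of A T] A by (metis le_inf_iff)
  have "vector_basis scale T B"
    using B subT by (simp add: vector_basis_def span_subspace)
  then obtain b where b: "bij_betw b {1..n} B" "\<forall>i\<in>{1..n}. b i \<notin> X i"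
    using ord by blast
  have finB: "finite B"
    using B(3) by (rule finiteI_independent)
  have cB: "card B = n"
    using bij_betw_same_card[OF b(1)] by simp
  have "card (b ` J) = card J"
    using b(1) J by (meson bij_betw_def card_image inj_on_subset)
  \<comment> \<open>For \<open>j\<close> in \<open>J\<close>, \<open>b j\<close> avoids
    \<open>X j\<close>, which contains the meet and hence \<open>A\<close>.\<close>
  moreover have "A \<inter> b ` J = {}"
    using A(1) b(2) J unfolding family_meet_def by blast
  moreover have "A \<union> b ` J \<subseteq> B"
    using B(1) b(1) J by (auto simp: bij_betw_def)
  ultimately have "card A + card J \<le> n"
    using finB cB by (metis card_Un_disjoint card_mono finite_subset le_sup_iff)
  moreover have "dim T + dim (family_meet X J) \<le> dim ?S + dimension"
    by (rule dim_add_le_dim_Int[OF subT subM])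
  ultimately show ?thesis
    using A(4) dT by simp
qed

lemma q_transversal_exists:
  assumes X: "\<And>i. i \<in> {1..n} \<Longrightarrow> subspace (X i)"
    and cond: "\<And>J. J \<subseteq> {1..n} \<Longrightarrow> dim (family_meet X J) + card J \<le> dimension"
  shows "\<exists>T. q_transversal scale n X T"
proof -
  obtain H where H: "\<forall>i\<in>{1..n}. subspace (H i) \<and> X i \<subseteq> H i \<and> dim (H i) + 1 = dimension"
      "dim (family_meet H {1..n}) + card {1..n} \<le> dimension"
    using hyperplanes_in_general_position_exist[of "{1..n}" X] assms by blast
  let ?M = "family_meet H {1..n}"
  have subM: "subspace ?M"
    using H subspace_family_meet by blast
  obtain T where T: "subspace T" "?M \<inter> T = {0}" "dim ?M + dim T = dimension"
    using subspace_complement_exists[OF subM] by blast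
  \<comment> \<open>The reverse of the bound in \<open>H(2)\<close>: \<open>?M\<close> has
    codimension exactly \<open>n\<close>.\<close>
  have "dim UNIV \<le> dim (UNIV \<inter> ?M) + card {1..n}"
    using H by (intro dim_Int_hyperplanes) auto
  then have dT: "dim T = n"
    using H(2) T(3) by (simp add: dimension_def)
  have "\<exists>b. bij_betw b {1..n} B \<and> (\<forall>i\<in>{1..n}. b i \<notin> X i)" if "vector_basis scale T B" for B
  proof -
    have B: "independent B" "span B = T"
      using that by (auto simp: vector_basis_def)
    have "card B = card {1..n}"
      using B dT by (metis card_atLeastAtMost diff_Suc_1 dim_span_eq_card_independent)
    then obtain b where "bij_betw b {1..n} B" "\<forall>i\<in>{1..n}. b i \<notin> H i"
      using hyperplanes_matching_exists[of "{1..n}" B H] B H T(2) by (auto simp: Int_commute)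
    then show ?thesis
      using H by blast
  qed
  then show ?thesis
    using T(1) dT by (auto simp: q_transversal_def)
qed

end

theorem theorem17:
  fixes scale :: "'a::field \<Rightarrow> 'b::ab_group_add \<Rightarrow> 'b"
    and Basis :: "'b set"
    and n :: nat
    and X :: "nat \<Rightarrow> 'b set"
  assumes "finite_dimensional_vector_space scale Basis"
    and "\<And>i. i \<in> {1..n} \<Longrightarrow> module.subspace scale (X i)"
  shows "(\<exists>T. q_transversal scale n X T) \<longleftrightarrow>
         (\<forall>J. J \<noteq> {} \<and> J \<subseteq> {1..n} \<longrightarrow>
            vector_space.dim scale (family_meet X J) + card J
              \<le> vector_space.dim scale (UNIV :: 'b set))"
proof -
  interpret finite_dimensional_vector_space scale Basis by fact
  have dim: "dim UNIV = dimension"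
    by (simp add: dimension_def)
  show ?thesis
  proof (intro iffI allI impI)
    fix J assume "\<exists>T. q_transversal scale n X T" "J \<noteq> {} \<and> J \<subseteq> {1..n}"
    then show "dim (family_meet X J) + card J \<le> dim UNIV"
      unfolding dim using q_transversal_imp_dim_le assms(2) by blast
  next
    assume cond: "\<forall>J. J \<noteq> {} \<and> J \<subseteq> {1..n} \<longrightarrow> dim (family_meet X J) + card J \<le> dim UNIV"
    \<comment> \<open>The empty set, whose meet is the whole space, is added here because
      \<open>J \<inter> K\<close> may be empty in the submodularity argument.\<close>
    have "dim (family_meet X J) + card J \<le> dimension" if "J \<subseteq> {1..n}" for J
      using cond that dim_subset_UNIV[of "family_meet X J"] unfolding dim by (cases "J = {}") auto
    then show "\<exists>T. q_transversal scale n X T"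
      using q_transversal_exists assms(2) by blast
  qed
qed

end
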